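(* Let $S$ be a cancellative right amenable semigroup, $A$ an abelian group, and $S\overset{\alpha}{\curvearrowright}A$ a left action by group endomorphisms. If $A$ is a direct limit of $\alpha$-invariant subgroups $\{A_i:i\in I\}$ (that is, $\{A_i:i\in I\}$ is a family of $\alpha$-invariant subgroups directed under inclusion with union $A$), then $$h_{alg}(\alpha)=\sup_{i\in I}h_{alg}(\alpha_{A_i}).$$
   Context: A semigroup $S$ is cancellative if all left and right multiplications are injective. $S$ is right amenable if there is a finitely additive $\mu:\mathcal P(S)\to[0,1]$ with $\mu(S)=1$ and $\mu(R_s^{-1}(F))=\mu(F)$ for all $s\in S$, $F\subseteq S$, where $R_s(x)=xs$. A right Følner net of $S$ is a net $(F_i)_{i\in I}$ of non-empty finite subsets of $S$ with $\lim_{i\in I}|F_is\setminus F_i|/|F_i|=0$ for every $s\in S$ (such nets exist when $S$ is cancellative right amenable). A left action $S\overset{\alpha}{\curvearrowright}A$ assigns to each $s\in S$ an endomorphism $\alpha(s)$ of $A$ with $\alpha(st)=\alpha(s)\circ\alpha(t)$ (and $\alpha(1)=\mathrm{id}_A$ if $S$ is a monoid). A subgroup $B\le A$ is $\alpha$-invariant if $\alpha(s)(B)\subseteq B$ for all $s\in S$; then $\alpha_B$ denotes the induced action of $S$ on $B$. For non-empty finite $X\subseteq A$ and non-empty finite $F\subseteq S$ put $T_F(\alpha,X)=\sum_{s\in F}\alpha(s)(X)$ (sum of subsets). Set $H_{alg}(\alpha,X)=\lim_{i\in I}\frac{\log|T_{F_i}(\alpha,X)|}{|F_i|}$ for any right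 Følner net $(F_i)_{i\in I}$ of $S$; the limit is known to exist, to be finite, and not to depend on the net. Define $h_{alg}(\alpha)=\sup\{H_{alg}(\alpha,X):X\subseteq A\text{ non-empty finite}\}\in[0,\infty]$. *)

theory Defs
  imports Complex_Main "HOL-Library.Extended_Real" "HOL-Algebra.Coset" "HOL-Algebra.FiniteProduct"
begin

(* Semigroups are types of class semigroup_mult; abelian groups are HOL-Algebra comm_groups,
   written multiplicatively there, so that subgroups are groups in their own right.
   In particular the "sum of subsets" below appears as a product. *)

definition cancellative :: "'s::semigroup_mult itself \<Rightarrow> bool" where
  "cancellative _ \<longleftrightarrow> (\<forall>s::'s. inj (\<lambda>x. s * x) \<and> inj (\<lambda>x. x * s))"

definition right_invariant_mean :: "('s::semigroup_mult set \<Rightarrow> real) \<Rightarrow> bool" where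
  "right_invariant_mean \<mu> \<longleftrightarrow>
     (\<forall>E. 0 \<le> \<mu> E \<and> \<mu> E \<le> 1) \<and>
     (\<forall>E F. E \<inter> F = {} \<longrightarrow> \<mu> (E \<union> F) = \<mu> E + \<mu> F) \<and>
     \<mu> UNIV = 1 \<and>
     (\<forall>s E. \<mu> ((\<lambda>x. x * s) -` E) = \<mu> E)"

definition right_amenable :: "'s::semigroup_mult itself \<Rightarrow> bool" where
  "right_amenable _ \<longleftrightarrow> (\<exists>\<mu> :: 's set \<Rightarrow> real. right_invariant_mean \<mu>)"

definition directed_set :: "'i set \<Rightarrow> ('i \<Rightarrow> 'i \<Rightarrow> bool) \<Rightarrow> bool" where
  "directed_set I R \<longleftrightarrow> I \<noteq> {} \<and> reflp_on I R \<and> transp_on I R \<and>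
     (\<forall>i\<in>I. \<forall>j\<in>I. \<exists>k\<in>I. R i k \<and> R j k)"

(* The filter of tails of a directed set: convergence along this filter is convergence of nets. *)
definition net_filter :: "'i set \<Rightarrow> ('i \<Rightarrow> 'i \<Rightarrow> bool) \<Rightarrow> 'i filter" where
  "net_filter I R = (INF i\<in>I. principal {j \<in> I. R i j})"

lemma eventually_net_filter:
  assumes "directed_set I R"
  shows "eventually P (net_filter I R) \<longleftrightarrow> (\<exists>i\<in>I. \<forall>j\<in>I. R i j \<longrightarrow> P j)"
proof -
  have "\<exists>k\<in>I. principal {l \<in> I. R k l} \<le> inf (principal {l \<in> I. R i l}) (principal {l \<in> I. R j l})"
    if ij: "i \<in> I" "j \<in> I" for i j
  proof -
    obtain k where k: "k \<in> I" "R i k" "R j k"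
      using assms ij unfolding directed_set_def by blast
    have "R i l \<and> R j l" if "l \<in> I" "R k l" for l
      using assms ij k that unfolding directed_set_def by (meson transp_onD)
    with k show ?thesis by auto
  qed
  with assms show ?thesis
    unfolding net_filter_def
    by (subst eventually_INF_base) (auto simp: eventually_principal directed_set_def)
qed

definition right_folner_net ::
    "'i set \<Rightarrow> ('i \<Rightarrow> 'i \<Rightarrow> bool) \<Rightarrow> ('i \<Rightarrow> 's::semigroup_mult set) \<Rightarrow> bool" where
  "right_folner_net I R F \<longleftrightarrow> directed_set I R \<and>
     (\<forall>i\<in>I. finite (F i) \<and> F i \<noteq> {}) \<and>
     (\<forall>s. ((\<lambda>i. real (card ((\<lambda>x. x * s) ` F i - F i)) / real (card (F i))) \<longlongrightarrow> 0) (net_filter I R))"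

(* An action is determined by its values on the carrier of A. The last clause only has content
   when the semigroup happens to be a monoid, with identity e. *)
definition left_action :: "('a, 'm) monoid_scheme \<Rightarrow> ('s::semigroup_mult \<Rightarrow> 'a \<Rightarrow> 'a) \<Rightarrow> bool" where
  "left_action A \<alpha> \<longleftrightarrow>
     (\<forall>s. \<alpha> s \<in> hom A A) \<and>
     (\<forall>s t. \<forall>x\<in>carrier A. \<alpha> (s * t) x = \<alpha> s (\<alpha> t x)) \<and>
     (\<forall>e. (\<forall>s. e * s = s \<and> s * e = s) \<longrightarrow> (\<forall>x\<in>carrier A. \<alpha> e x = x))"

definition invariant_subgroup ::
    "('a, 'm) monoid_scheme \<Rightarrow> ('s \<Rightarrow> 'a \<Rightarrow> 'a) \<Rightarrow> 'a set \<Rightarrow> bool" where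
  "invariant_subgroup A \<alpha> B \<longleftrightarrow> subgroup B A \<and> (\<forall>s. \<alpha> s ` B \<subseteq> B)"

definition induced_action :: "('s \<Rightarrow> 'a \<Rightarrow> 'a) \<Rightarrow> 'a set \<Rightarrow> 's \<Rightarrow> 'a \<Rightarrow> 'a" where
  "induced_action \<alpha> B = (\<lambda>s. restrict (\<alpha> s) B)"

definition trajectory ::
    "('a, 'm) monoid_scheme \<Rightarrow> ('s \<Rightarrow> 'a \<Rightarrow> 'a) \<Rightarrow> 's set \<Rightarrow> 'a set \<Rightarrow> 'a set" where
  "trajectory A \<alpha> F X = {finprod A y F | y. \<forall>s\<in>F. y s \<in> \<alpha> s ` X}"

(* The common limit along all right Folner nets. HOL cannot quantify over index types inside
   a term, so one fixed index type is used; by right_folner_net_reindex this is no restriction. *)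
definition H_alg ::
    "('a, 'm) monoid_scheme \<Rightarrow> ('s::semigroup_mult \<Rightarrow> 'a \<Rightarrow> 'a) \<Rightarrow> 'a set \<Rightarrow> real" where
  "H_alg A \<alpha> X =
     (THE h. \<forall>(I :: ('s set \<times> 's set set) set) R F. right_folner_net I R F \<longrightarrow>
        ((\<lambda>i. ln (real (card (trajectory A \<alpha> (F i) X))) / real (card (F i))) \<longlongrightarrow> h) (net_filter I R))"

definition h_alg :: "('a, 'm) monoid_scheme \<Rightarrow> ('s::semigroup_mult \<Rightarrow> 'a \<Rightarrow> 'a) \<Rightarrow> ereal" where
  "h_alg A \<alpha> = (SUP X\<in>{X. X \<subseteq> carrier A \<and> finite X \<and> X \<noteq> {}}. ereal (H_alg A \<alpha> X))"

(* Every right Folner net, with any index type, can be replaced by one with the index type used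
   in H_alg such that any function of the finite sets has the same limits along both nets. *)
lemma right_folner_net_reindex:
  fixes F :: "'i \<Rightarrow> 's::semigroup_mult set"
  assumes "right_folner_net I R F"
  obtains J :: "('s set \<times> 's set set) set" and R' G where
    "right_folner_net J R' G"
    "\<And>(\<phi> :: 's set \<Rightarrow> real) h.
       ((\<lambda>j. \<phi> (G j)) \<longlongrightarrow> h) (net_filter J R') \<longleftrightarrow> ((\<lambda>i. \<phi> (F i)) \<longlongrightarrow> h) (net_filter I R)"
proof -
  have dir: "directed_set I R" and fin: "\<And>i. i \<in> I \<Longrightarrow> finite (F i) \<and> F i \<noteq> {}"
    and lim: "\<And>s. ((\<lambda>i. real (card ((\<lambda>x. x * s) ` F i - F i)) / real (card (F i))) \<longlongrightarrow> 0) (net_filter I R)"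
    using assms unfolding right_folner_net_def by auto
  define K where "K = net_filter I R"
  have ev: "eventually P K \<longleftrightarrow> (\<exists>i\<in>I. \<forall>j\<in>I. R i j \<longrightarrow> P j)" for P
    unfolding K_def using dir by (rule eventually_net_filter)
  have evI: "eventually (\<lambda>i. i \<in> I) K"
    using dir by (auto simp: ev directed_set_def)
  have ne: "\<exists>i\<in>I. P i" if "eventually P K" for P
    using that dir unfolding ev directed_set_def reflp_on_def by blast
  define J where "J = {(x, M). x \<in> M \<and> M \<subseteq> F ` I \<and> eventually (\<lambda>i. F i \<in> M) K}"
  define R' where "R' = (\<lambda>(p :: 's set \<times> 's set set) (q :: 's set \<times> 's set set). snd q \<subseteq> snd p)"
  have inJ: "\<exists>x. (x, {y \<in> F ` I. P y}) \<in> J" if P: "eventually (\<lambda>i. P (F i)) K" for P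
  proof -
    obtain i where "i \<in> I" "P (F i)"
      using ne[OF P] by auto
    moreover have "eventually (\<lambda>i. F i \<in> {y \<in> F ` I. P y}) K"
      using P evI by eventually_elim auto
    ultimately show ?thesis unfolding J_def by blast
  qed
  have dirJ: "directed_set J R'"
    unfolding directed_set_def
  proof (intro conjI ballI)
    show "J \<noteq> {}" using inJ[of "\<lambda>_. True"] by auto
    show "reflp_on J R'" "transp_on J R'"
      unfolding R'_def by (auto simp: reflp_on_def transp_on_def)
    fix p q assume "p \<in> J" "q \<in> J"
    then have "eventually (\<lambda>i. F i \<in> snd p \<and> F i \<in> snd q) K"
      unfolding J_def by (auto intro: eventually_conj)
    then obtain x where "(x, {y \<in> F ` I. y \<in> snd p \<and> y \<in> snd q}) \<in> J"
      using inJ[of "\<lambda>y. y \<in> snd p \<and> y \<in> snd q"] by blast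
    then show "\<exists>r\<in>J. R' p r \<and> R' q r"
      unfolding R'_def by (rule bexI[rotated]) auto
  qed
  have eq: "filtermap fst (net_filter J R') = filtermap F K"
  proof (rule filter_eqI)
    fix P
    show "eventually P (filtermap fst (net_filter J R')) \<longleftrightarrow> eventually P (filtermap F K)"
      unfolding eventually_filtermap eventually_net_filter[OF dirJ]
    proof
      assume "\<exists>p\<in>J. \<forall>q\<in>J. R' p q \<longrightarrow> P (fst q)"
      then obtain x M where xM: "(x, M) \<in> J" and P: "\<And>q. q \<in> J \<Longrightarrow> R' (x, M) q \<Longrightarrow> P (fst q)"
        by auto
      have "P y" if "y \<in> M" for y
        using P[of "(y, M)"] xM that unfolding J_def R'_def by auto
      moreover have "eventually (\<lambda>i. F i \<in> M) K" using xM unfolding J_def by auto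
      ultimately show "eventually (\<lambda>i. P (F i)) K" by (auto elim: eventually_mono)
    next
      assume "eventually (\<lambda>i. P (F i)) K"
      from inJ[OF this] obtain x where "(x, {y \<in> F ` I. P y}) \<in> J" by blast
      then show "\<exists>p\<in>J. \<forall>q\<in>J. R' p q \<longrightarrow> P (fst q)"
        by (rule bexI[rotated]) (auto simp: J_def R'_def)
    qed
  qed
  have iff: "((\<lambda>j. \<phi> (fst j)) \<longlongrightarrow> h) (net_filter J R') \<longleftrightarrow> ((\<lambda>i. \<phi> (F i)) \<longlongrightarrow> h) (net_filter I R)"
    for \<phi> :: "'s set \<Rightarrow> real" and h
    using eq unfolding filterlim_def K_def by (simp add: filtermap_filtermap[symmetric])
  have "right_folner_net J R' fst"
    unfolding right_folner_net_def
  proof (intro conjI dirJ ballI allI)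
    fix p assume "p \<in> J"
    then have "fst p \<in> F ` I" unfolding J_def by auto
    then show "finite (fst p)" "fst p \<noteq> {}" using fin by auto
  next
    fix s :: 's
    show "((\<lambda>i. real (card ((\<lambda>x. x * s) ` fst i - fst i)) / real (card (fst i))) \<longlongrightarrow> 0) (net_filter J R')"
      using iff[of "\<lambda>E. real (card ((\<lambda>x. x * s) ` E - E)) / real (card E)" 0] lim[of s] by simp
  qed
  from that[OF this iff] show thesis .
qed

end

theory Submission
  imports Defs
begin

text \<open>For a finite X inside an invariant subgroup B, the trajectories of X computed in B and
  in A are the same sets, so \<open>H_alg\<close> of X is the same number in both
  (\<open>H_alg_induced_action\<close>). Hence both sides of the theorem are suprema of one function
  X \<mapsto> \<open>H_alg A \<alpha> X\<close>, and only the ranges of X need comparing. By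
  directedness, every finite subset of A already lies in a single \<open>B i\<close>
  (\<open>finite_subset_directed_UN\<close>), so the ranges agree.\<close>

lemma finprod_carrier_update:
  assumes "comm_group A" "subgroup B A" "y \<in> F \<rightarrow> B"
  shows "finprod (A\<lparr>carrier := B\<rparr>) y F = finprod A y F"
proof -
  interpret A: comm_group A by fact
  interpret B: comm_group "A\<lparr>carrier := B\<rparr>"
    using A.subgroup_imp_group[OF assms(2)] subgroup.subset[OF assms(2)]
    by (intro group.group_comm_groupI) (auto simp: A.m_comm subset_iff)
  \<comment> \<open>\<open>finprod\<close> is a fold whose definition refers to the carrier, so the
    two products are compared one factor at a time.\<close>
  show ?thesis
    using assms(3)
  proof (induction F rule: infinite_finite_induct)
    case (insert s F)
    then have "y \<in> insert s F \<rightarrow> carrier A"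
      using subgroup.subset[OF assms(2)] by blast
    with insert show ?case
      by (auto simp: Pi_iff)
  next
    case empty
    show ?case
      using B.finprod_empty by simp
  next
    \<comment> \<open>Over an infinite index set \<open>finprod\<close> defaults to the unit, which
      the subgroup shares with \<open>A\<close>.\<close>
    case (infinite F)
    then show ?case
      using B.finprod_infinite by simp
  qed
qed

lemma trajectory_induced_action:
  fixes A :: "('a, 'm) monoid_scheme"
  assumes "comm_group A" "invariant_subgroup A \<alpha> B" "X \<subseteq> B"
  shows "trajectory (A\<lparr>carrier := B\<rparr>) (induced_action \<alpha> B) F X = trajectory A \<alpha> F X"
proof -
  have B: "subgroup B A" "\<And>s. \<alpha> s ` B \<subseteq> B"
    using assms(2) by (auto simp: invariant_subgroup_def)
  have image: "induced_action \<alpha> B s ` X = \<alpha> s ` X" for s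
    using assms(3) by (auto simp: induced_action_def intro!: image_cong)
  have "finprod (A\<lparr>carrier := B\<rparr>) y F = finprod A y F" if "\<forall>s\<in>F. y s \<in> \<alpha> s ` X" for y
    using that B assms(1,3) by (intro finprod_carrier_update) blast+
  then show ?thesis
    unfolding trajectory_def image by (intro Collect_cong ex_cong1) auto
qed

text \<open>\<open>H_alg\<close> sees the group and the action only through trajectories, so both
  sides are definite descriptions of the same predicate.\<close>

lemma H_alg_induced_action:
  assumes "comm_group A" "invariant_subgroup A \<alpha> B" "X \<subseteq> B"
  shows "H_alg (A\<lparr>carrier := B\<rparr>) (induced_action \<alpha> B) X = H_alg A \<alpha> X"
  by (simp add: H_alg_def trajectory_induced_action[OF assms])

text \<open>Each point lies in some member, and directedness merges finitely many members into one;
  nonemptiness of \<open>I\<close> serves the case of empty \<open>X\<close>.\<close>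

lemma finite_subset_directed_UN:
  assumes "I \<noteq> {}"
    and "\<And>i j. i \<in> I \<Longrightarrow> j \<in> I \<Longrightarrow> \<exists>k\<in>I. B i \<subseteq> B k \<and> B j \<subseteq> B k"
    and "finite X" "X \<subseteq> (\<Union>i\<in>I. B i)"
  shows "\<exists>i\<in>I. X \<subseteq> B i"
  using assms(3,4)
proof (induction rule: finite_induct)
  case empty
  with assms(1) show ?case by auto
next
  case (insert x X)
  then obtain i j where "i \<in> I" "X \<subseteq> B i" "j \<in> I" "x \<in> B j"
    by auto
  with assms(2)[of i j] show ?case by blast
qed

theorem proposition4p18:
  fixes A :: "('a, 'm) monoid_scheme"
    and \<alpha> :: "'s::semigroup_mult \<Rightarrow> 'a \<Rightarrow> 'a"
    and I :: "'i set"
    and B :: "'i \<Rightarrow> 'a set"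
  assumes "cancellative TYPE('s)"
    and "right_amenable TYPE('s)"
    and "comm_group A"
    and "left_action A \<alpha>"
    and "I \<noteq> {}"
    and "\<And>i. i \<in> I \<Longrightarrow> invariant_subgroup A \<alpha> (B i)"
    and "\<And>i j. i \<in> I \<Longrightarrow> j \<in> I \<Longrightarrow> \<exists>k\<in>I. B i \<subseteq> B k \<and> B j \<subseteq> B k"
    and "(\<Union>i\<in>I. B i) = carrier A"
  shows "h_alg A \<alpha> = (SUP i\<in>I. h_alg (A\<lparr>carrier := B i\<rparr>) (induced_action \<alpha> (B i)))"
proof -
  define fin where "fin C = {X. X \<subseteq> C \<and> finite X \<and> X \<noteq> {}}" for C :: "'a set"
  \<comment> \<open>The entropy of each subgroup becomes a supremum of the ambient function
    \<open>H_alg A \<alpha>\<close>, over fewer sets.\<close>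
  have h_B: "h_alg (A\<lparr>carrier := B i\<rparr>) (induced_action \<alpha> (B i)) = (SUP X\<in>fin (B i). ereal (H_alg A \<alpha> X))"
    if "i \<in> I" for i
    unfolding h_alg_def fin_def
    by (intro SUP_cong) (simp_all add: H_alg_induced_action[OF assms(3) assms(6)[OF that]])
  \<comment> \<open>This is where directedness enters: a supremum over this union is then an
    iterated supremum, first over X and then over i.\<close>
  have "fin (carrier A) = (\<Union>i\<in>I. fin (B i))"
  proof (intro equalityI subsetI)
    fix X assume "X \<in> fin (carrier A)"
    moreover from this have "\<exists>i\<in>I. X \<subseteq> B i"
      by (intro finite_subset_directed_UN[OF assms(5,7)]) (auto simp: fin_def assms(8))
    ultimately show "X \<in> (\<Union>i\<in>I. fin (B i))"
      by (auto simp: fin_def)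
  qed (auto simp: fin_def assms(8)[symmetric])
  then have "h_alg A \<alpha> = (SUP i\<in>I. SUP X\<in>fin (B i). ereal (H_alg A \<alpha> X))"
    unfolding h_alg_def fin_def[symmetric] by (simp add: SUP_UNION)
  with h_B show ?thesis
    by simp
qed

end
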